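(* Let $\lambda$ be a nonzero real number and let $g(t)=-\frac{1}{1-t}\log_{\lambda}(1-t)$. For every $k\in\mathbb{N}$, $$g^{(k)}(t)=\left(\frac{d}{dt}\right)^{k}g(t)=\frac{k!}{(1-t)^{k+1}}\left(-\binom{k-\lambda}{k}\log_{\lambda}(1-t)+H_{k,\lambda}\right),$$ and $$g^{(k)}(0)=k!\,H_{k,\lambda}.$$
   Context: $\mathbb{N}=\{1,2,3,\dots\}$. For real $a$ and integer $k\ge0$, $\binom{a}{k}=a(a-1)\cdots(a-k+1)/k!$. The degenerate logarithm $\log_\lambda t$ is the compositional inverse of the degenerate exponential $e_\lambda(t)=\sum_{n\ge0}\frac{(1)_{n,\lambda}}{n!}t^n$, where $(y)_{0,\lambda}=1$ and $(y)_{n,\lambda}=y(y-\lambda)\cdots(y-(n-1)\lambda)$; explicitly, $\log_\lambda(1+t)=\sum_{n=1}^{\infty}\frac{\lambda^{n-1}(1)_{n,1/\lambda}}{n!}t^n$ as a power series in $t$. Degenerate harmonic numbers: $H_{0,\lambda}=0$ and $H_{n,\lambda}=\sum_{k=1}^{n}\frac{1}{\lambda}\binom{\lambda}{k}(-1)^{k-1}$ for $n\ge1$. The function $g$ is regarded as a formal power series in $t$. *)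

theory Defs
  imports Complex_Main "HOL-Computational_Algebra.Formal_Power_Series"
begin

unbundle fps_syntax

definition deg_ffact :: "real \<Rightarrow> real \<Rightarrow> nat \<Rightarrow> real" where
  "deg_ffact lam y n = (\<Prod>i<n. y - of_nat i * lam)"

definition deg_exp :: "real \<Rightarrow> real fps" where
  "deg_exp lam = Abs_fps (\<lambda>n. deg_ffact lam 1 n / fact n)"

text \<open>\<open>deg_exp lam\<close> has constant term 1, so its compositional inverse, the degenerate logarithm,
  is a power series around 1: \<open>deg_log1p lam\<close> is the series of log(1 + t), and \<open>deg_log1m lam\<close> that of
  log(1 - t). The coefficients of the former are computed in \<open>deg_log1p_explicit\<close>.\<close>
definition deg_log1p :: "real \<Rightarrow> real fps" where
  "deg_log1p lam = fps_inv (deg_exp lam - 1)"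

definition deg_log1m :: "real \<Rightarrow> real fps" where
  "deg_log1m lam = deg_log1p lam oo (- fps_X)"

definition deg_g :: "real \<Rightarrow> real fps" where
  "deg_g lam = - (1 / (1 - fps_X)) * deg_log1m lam"

definition deg_harm :: "nat \<Rightarrow> real \<Rightarrow> real" where
  "deg_harm n lam = (\<Sum>k=1..n. 1 / lam * (lam gchoose k) * (-1) ^ (k - 1))"

lemma deg_ffact_gbinomial:
  assumes "lam \<noteq> 0"
  shows "deg_ffact lam 1 n / fact n = lam ^ n * ((1 / lam) gchoose n)"
proof -
  have "deg_ffact lam 1 n = (\<Prod>i<n. lam * (1 / lam - of_nat i))"
    unfolding deg_ffact_def using assms by (intro prod.cong) (auto simp: field_simps)
  also have "\<dots> = lam ^ n * (\<Prod>i<n. 1 / lam - of_nat i)"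
    by (simp add: prod.distrib)
  finally show ?thesis
    by (simp add: gbinomial_prod_rev lessThan_atLeast0)
qed

lemma deg_ffact_gbinomial':
  assumes "lam \<noteq> 0" "n \<ge> 1"
  shows "lam ^ (n - 1) * deg_ffact (1 / lam) 1 n / fact n = (lam gchoose n) / lam"
proof -
  from assms(2) have "lam ^ n = lam * lam ^ (n - 1)"
    by (cases n) auto
  with assms(1) deg_ffact_gbinomial[of "1 / lam" n] show ?thesis
    by (simp add: power_divide field_simps)
qed

lemma deg_exp_nth_0: "deg_exp lam $ 0 = 1" and deg_exp_nth_1: "deg_exp lam $ Suc 0 = 1"
  by (simp_all add: deg_exp_def deg_ffact_def)

lemma deg_exp_comp_deg_log1p: "(deg_exp lam - 1) oo deg_log1p lam = fps_X"
  unfolding deg_log1p_def by (rule fps_inv_right) (simp_all add: deg_exp_nth_0 deg_exp_nth_1)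

lemma deg_log1p_comp_deg_exp: "deg_log1p lam oo (deg_exp lam - 1) = fps_X"
  unfolding deg_log1p_def by (rule fps_inv) (simp_all add: deg_exp_nth_0 deg_exp_nth_1)

lemma deg_exp_ODE: "(1 + fps_const lam * fps_X) * fps_deriv (deg_exp lam) = deg_exp lam"
proof (rule fps_ext)
  fix n
  have *: "of_nat (Suc m) * (deg_ffact lam 1 (Suc m) / fact (Suc m)) =
             (1 - of_nat m * lam) * (deg_ffact lam 1 m / fact m)" for m
    by (simp add: deg_ffact_def field_simps del: of_nat_Suc)
  show "((1 + fps_const lam * fps_X) * fps_deriv (deg_exp lam)) $ n = deg_exp lam $ n"
  proof (cases n)
    case 0
    then show ?thesis
      by (simp add: deg_exp_def deg_ffact_def)
  next
    case (Suc m)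
    have "((1 + fps_const lam * fps_X) * fps_deriv (deg_exp lam)) $ n =
      of_nat (Suc n) * (deg_ffact lam 1 (Suc n) / fact (Suc n)) +
      lam * (of_nat n * (deg_ffact lam 1 n / fact n))"
      using Suc by (simp add: deg_exp_def distrib_right mult.assoc del: fact_Suc of_nat_Suc)
    also have "\<dots> = deg_ffact lam 1 n / fact n"
      unfolding * by (simp add: algebra_simps diff_divide_distrib)
    finally show ?thesis
      by (simp add: deg_exp_def)
  qed
qed

lemma deg_log1p_binomial:
  assumes "lam \<noteq> 0"
  shows "deg_log1p lam = fps_const (1 / lam) * (fps_binomial lam - 1)"
proof -
  define L where "L = fps_const (1 / lam) * (fps_binomial lam - 1)"
  define F where "F = deg_exp lam oo L"
  have L0: "L $ 0 = 0"
    by (simp add: L_def)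
  have L: "1 + fps_const lam * L = fps_binomial lam"
    using assms by (simp add: L_def mult.assoc[symmetric])
  have "fps_deriv (fps_binomial lam) = fps_const lam * fps_binomial lam / (1 + fps_X)"
    by (rule fps_binomial_deriv)
  then have "fps_deriv (fps_binomial lam) * (1 + fps_X) = fps_const lam * fps_binomial lam"
    by (simp add: fps_divide_unit mult.assoc inverse_mult_eq_1)
  then have L': "fps_deriv L * (1 + fps_X) = fps_binomial lam"
    using assms by (simp add: L_def mult.assoc)
  have "(1 + fps_const lam * L) * (fps_deriv (deg_exp lam) oo L) = F"
    unfolding F_def using arg_cong[OF deg_exp_ODE[of lam], of "\<lambda>f. f oo L"] L0
    by (simp add: fps_compose_mult_distrib fps_compose_add_distrib)
  then have "fps_binomial lam * (fps_deriv (deg_exp lam) oo L) = F"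
    unfolding L .
  then have "fps_deriv F * (1 + fps_X) = F"
    unfolding F_def fps_compose_deriv[OF L0] L'[symmetric] by (simp only: mult_ac)
  moreover have "(1 + fps_X :: real fps) $ 0 \<noteq> 0"
    by simp
  then have "(1 + fps_X :: real fps) \<noteq> 0"
    by force
  ultimately have "fps_deriv F = fps_const 1 * F / (1 + fps_X)"
    by (metis fps_const_1_eq_1 mult_1 nonzero_mult_div_cancel_right)
  then have "F = fps_const (F $ 0) * fps_binomial 1"
    using fps_binomial_ODE_unique[of F 1] by blast
  moreover have "F $ 0 = 1"
    by (simp add: F_def deg_exp_nth_0)
  ultimately have F: "F = 1 + fps_X"
    using fps_binomial_1 by simp
  have inv: "(deg_exp lam - 1) oo L = fps_X"
    using F by (simp add: F_def fps_compose_sub_distrib)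
  have "L = deg_log1p lam oo (deg_exp lam - 1) oo L"
    by (simp add: deg_log1p_comp_deg_exp L0)
  also have "\<dots> = deg_log1p lam oo ((deg_exp lam - 1) oo L)"
    by (rule fps_compose_assoc[symmetric]) (simp_all add: L0 deg_exp_nth_0)
  finally show ?thesis
    unfolding inv by (simp add: L_def)
qed

lemma deg_log1p_explicit:
  assumes "lam \<noteq> 0"
  shows "deg_log1p lam =
    Abs_fps (\<lambda>n. if n = 0 then 0 else lam ^ (n - 1) * deg_ffact (1 / lam) 1 n / fact n)"
proof (rule fps_ext)
  fix n
  show "deg_log1p lam $ n =
    Abs_fps (\<lambda>n. if n = 0 then 0 else lam ^ (n - 1) * deg_ffact (1 / lam) 1 n / fact n) $ n"
    using assms deg_ffact_gbinomial'[OF assms, of n]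
    by (cases "n = 0") (simp_all add: deg_log1p_binomial)
qed

end

theory Submission
  imports Defs
begin

text \<open>
  Write \<open>L\<close> for the series of \<open>log\<^sub>\<lambda>(1 - t)\<close> and \<open>u = 1 / (1 - t)\<close>, so that \<open>g = - u L\<close>.
  Since \<open>L = ((1 - t)\<^sup>\<lambda> - 1) / \<lambda>\<close>, differentiation gives \<open>L' = - u (1 + \<lambda> L)\<close>, while \<open>u' = u\<^sup>2\<close>.
  Hence the series of the form \<open>u\<^sup>k\<^sup>+\<^sup>1 (- c L + h)\<close> with constants \<open>c\<close> and \<open>h\<close> are mapped by
  differentiation to series of the same form with exponent \<open>k + 2\<close>:
  the pair \<open>(c, h)\<close> becomes \<open>((k + 1 - \<lambda>) c, (k + 1) h + c)\<close>
  (\<open>fps_deriv_inverse_power_log1m\<close>). After splitting off the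
  factor \<open>k!\<close>, the coefficient \<open>c\<close> follows the absorption law of \<open>binom(k - \<lambda>, k)\<close>
  (\<open>gbinomial_shifted_rec\<close>), and \<open>h\<close> grows by \<open>binom(k - \<lambda>, k) / (k + 1)\<close>. Reflecting the upper
  index shows that this is exactly the next term of the degenerate harmonic number
  (\<open>deg_harm_Suc\<close>). The induction starts at \<open>k = 0\<close> from \<open>g\<close> itself, where \<open>c = 1\<close> and \<open>h = 0\<close>.
  The value at \<open>0\<close> is read off from \<open>L(0) = 0\<close> and \<open>u(0) = 1\<close>.
\<close>

lemma deg_log1p_ODE:
  assumes "lam \<noteq> 0"
  shows "(1 + fps_X) * fps_deriv (deg_log1p lam) = 1 + fps_const lam * deg_log1p lam"
proof -
  have "fps_deriv (fps_binomial lam) = fps_const lam * fps_binomial lam / (1 + fps_X)"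
    by (rule fps_binomial_deriv)
  then have "(1 + fps_X) * fps_deriv (fps_binomial lam) = fps_const lam * fps_binomial lam"
    by (simp add: fps_divide_unit mult.assoc mult.left_commute[of "1 + fps_X"] inverse_mult_eq_1')
  then show ?thesis
    using assms by (simp add: deg_log1p_binomial mult.assoc[symmetric])
      (simp add: mult.assoc mult.left_commute[of _ "fps_const (1 / lam)"])
qed

lemma deg_log1m_ODE:
  assumes "lam \<noteq> 0"
  shows "fps_deriv (deg_log1m lam) =
           - (inverse (1 - fps_X) * (1 + fps_const lam * deg_log1m lam))"
proof -
  have u: "inverse (1 - fps_X) * (1 - fps_X) = (1 :: real fps)"
    by (rule inverse_mult_eq_1) simp
  have "(1 - fps_X) * (fps_deriv (deg_log1p lam) oo - fps_X) = 1 + fps_const lam * deg_log1m lam"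
    using arg_cong[OF deg_log1p_ODE[OF assms], of "\<lambda>f. f oo - fps_X"]
    by (simp add: deg_log1m_def fps_compose_mult_distrib fps_compose_add_distrib)
  moreover have "fps_deriv (deg_log1m lam) = - (fps_deriv (deg_log1p lam) oo - fps_X)"
    by (simp add: deg_log1m_def fps_compose_deriv)
  ultimately have "(1 - fps_X) * fps_deriv (deg_log1m lam) =
                     - (1 + fps_const lam * deg_log1m lam)"
    by simp
  then have "inverse (1 - fps_X) * ((1 - fps_X) * fps_deriv (deg_log1m lam)) =
               inverse (1 - fps_X) * - (1 + fps_const lam * deg_log1m lam)"
    by simp
  then show ?thesis
    by (simp only: mult.assoc[symmetric] u mult_1_left mult_minus_right)
qed

lemma fps_deriv_inverse_power_log1m:
  assumes "lam \<noteq> 0"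
  shows "fps_deriv (inverse (1 - fps_X) ^ (k + 1) * (- fps_const c * deg_log1m lam + fps_const h)) =
           inverse (1 - fps_X) ^ (k + 2) *
             (- fps_const ((of_nat (k + 1) - lam) * c) * deg_log1m lam
               + fps_const (of_nat (k + 1) * h + c))"
proof -
  define u where "u = inverse (1 - fps_X :: real fps)"
  have "fps_deriv u = u ^ 2"
    by (simp add: u_def fps_inverse_deriv)
  then have "fps_deriv (u ^ (k + 1)) = fps_const (of_nat (k + 1)) * u ^ (k + 2)"
    by (simp only: fps_deriv_power add_diff_cancel_right') (simp only: power_add mult_ac)
  moreover have "fps_deriv (deg_log1m lam) = - (u * (1 + fps_const lam * deg_log1m lam))"
    unfolding u_def by (rule deg_log1m_ODE[OF assms])
  ultimately have
    "fps_deriv (u ^ (k + 1) * (- fps_const c * deg_log1m lam + fps_const h)) =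
       u ^ (k + 1) * (fps_const c * (u * (1 + fps_const lam * deg_log1m lam))) +
       fps_const (of_nat (k + 1)) * u ^ (k + 2) * (- fps_const c * deg_log1m lam + fps_const h)"
    by (simp flip: fps_const_neg)
  also have "\<dots> = u ^ (k + 2) *
             (- (fps_const (of_nat (k + 1)) - fps_const lam) * fps_const c * deg_log1m lam
               + (fps_const (of_nat (k + 1)) * fps_const h + fps_const c))"
    by (simp only: power_add power_one_right power2_eq_square) algebra
  finally show ?thesis
    by (simp only: u_def fps_const_mult fps_const_add fps_const_sub fps_const_neg minus_mult_left)
qed

text \<open>
  Passing from \<open>k\<close> to \<open>k + 1\<close> raises the upper index as well as the lower one, so the product
  \<open>(k - \<lambda>) \<cdots> (1 - \<lambda>)\<close> gains its new factor at the top.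
\<close>

lemma gbinomial_shifted_rec:
  fixes a :: "'a :: field_char_0"
  shows "of_nat (k + 1) * ((of_nat (k + 1) - a) gchoose (k + 1)) =
           (of_nat (k + 1) - a) * ((of_nat k - a) gchoose k)"
  using gbinomial_absorption[of k "of_nat (k + 1) - a"] by (simp add: algebra_simps)

text \<open>
  Absorption cancels the factor \<open>1 / \<lambda>\<close> in the new term \<open>(1 / \<lambda>) binom(\<lambda>, k + 1) (-1)\<^sup>k\<close>, and
  reflecting the upper index of the remaining \<open>binom(\<lambda> - 1, k)\<close> cancels the sign.
\<close>

lemma deg_harm_Suc:
  assumes "lam \<noteq> 0"
  shows "of_nat (k + 1) * deg_harm (k + 1) lam =
           of_nat (k + 1) * deg_harm k lam + ((of_nat k - lam) gchoose k)"
proof -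
  have "(lam - 1) gchoose k = (-1) ^ k * ((of_nat k - lam) gchoose k)"
    by (subst gbinomial_negated_upper) simp
  then have "of_nat (k + 1) * (lam gchoose (k + 1)) * (-1) ^ k =
               lam * ((of_nat k - lam) gchoose k)"
    using gbinomial_absorption[of k lam] by (simp flip: power_mult_distrib)
  then show ?thesis
    using assms by (simp add: deg_harm_def field_simps)
qed

lemma deg_g_eq: "deg_g lam = - (inverse (1 - fps_X) * deg_log1m lam)"
  by (simp add: deg_g_def fps_divide_unit)

lemma fps_deriv_iterate_deg_g:
  assumes "lam \<noteq> 0"
  shows "(fps_deriv ^^ k) (deg_g lam) =
           fps_const (fact k) * (inverse (1 - fps_X) ^ (k + 1) *
             (- fps_const ((of_nat k - lam) gchoose k) * deg_log1m lam
               + fps_const (deg_harm k lam)))"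
proof (induction k)
  case 0
  show ?case
    by (simp add: deg_g_eq deg_harm_def)
next
  case (Suc k)
  define u where "u = inverse (1 - fps_X :: real fps)"
  let ?c = "\<lambda>k. (of_nat k - lam) gchoose k"
  have "(fps_deriv ^^ Suc k) (deg_g lam) = fps_const (fact k) *
          fps_deriv (u ^ (k + 1) *
            (- fps_const (?c k) * deg_log1m lam + fps_const (deg_harm k lam)))"
    unfolding u_def by (simp only: funpow.simps o_apply Suc.IH fps_deriv_mult_const_left)
  also have "\<dots> = fps_const (fact k) * (u ^ (k + 2) *
          (- fps_const ((of_nat (k + 1) - lam) * ?c k) * deg_log1m lam
            + fps_const (of_nat (k + 1) * deg_harm k lam + ?c k)))"
    unfolding u_def by (simp only: fps_deriv_inverse_power_log1m[OF assms])
  also have "\<dots> = fps_const (fact k) * (u ^ (k + 2) *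
          (- fps_const (of_nat (k + 1) * ?c (k + 1)) * deg_log1m lam
            + fps_const (of_nat (k + 1) * deg_harm (k + 1) lam)))"
    by (simp only: gbinomial_shifted_rec deg_harm_Suc[OF assms])
  also have "\<dots> = fps_const (of_nat (k + 1)) * fps_const (fact k) * (u ^ (k + 2) *
          (- fps_const (?c (k + 1)) * deg_log1m lam + fps_const (deg_harm (k + 1) lam)))"
    by (simp only: fps_const_mult[symmetric]) algebra
  also have "fps_const (of_nat (k + 1)) * fps_const (fact k) = fps_const (fact (k + 1) :: real)"
    by (simp add: algebra_simps)
  finally show ?case
    by (simp add: u_def)
qed

theorem theorem7:
  fixes lam :: real and k :: nat
  assumes "lam \<noteq> 0" and "k \<ge> 1"
  shows "(fps_deriv ^^ k) (deg_g lam) =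
           fps_const (fact k) / (1 - fps_X) ^ (k + 1) *
             (- fps_const ((of_nat k - lam) gchoose k) * deg_log1m lam + fps_const (deg_harm k lam)) \<and>
         fps_nth ((fps_deriv ^^ k) (deg_g lam)) 0 = fact k * deg_harm k lam"
proof
  have div: "fps_const (fact k) / (1 - fps_X) ^ (k + 1) =
               fps_const (fact k :: real) * inverse (1 - fps_X) ^ (k + 1)"
    by (subst fps_divide_unit) (simp_all only: fps_inverse_power, simp add: fps_nth_power_0)
  show "(fps_deriv ^^ k) (deg_g lam) =
          fps_const (fact k) / (1 - fps_X) ^ (k + 1) *
            (- fps_const ((of_nat k - lam) gchoose k) * deg_log1m lam + fps_const (deg_harm k lam))"
    unfolding div by (simp only: fps_deriv_iterate_deg_g[OF assms(1)] mult.assoc)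
  have "deg_log1m lam $ 0 = 0"
    using assms(1) by (simp add: deg_log1m_def deg_log1p_binomial)
  then show "fps_nth ((fps_deriv ^^ k) (deg_g lam)) 0 = fact k * deg_harm k lam"
    by (simp add: fps_deriv_iterate_deg_g[OF assms(1)] fps_nth_power_0)
qed

end
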